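(* Let $(\mathfrak{g},[\cdot,\cdot]_{\mathfrak{g}},s_{\mathfrak{g}},\alpha)$ be a Hom-Lie superalgebra in characteristic $2$ and let $(V,[\cdot,\cdot]_V,\beta)$ be a representation of it. On the superspace $\mathfrak{g}\oplus V=(\mathfrak{g}_{\bar 0}\oplus V_{\bar 0})\oplus(\mathfrak{g}_{\bar 1}\oplus V_{\bar 1})$ define $$[x+v,y+w]_{\mathfrak{g}\oplus V}:=[x,y]_{\mathfrak{g}}+[x,w]_V+[y,v]_V\quad(x,y\in\mathfrak{g},\ v,w\in V),$$ $$s_{\mathfrak{g}\oplus V}(x+v):=s_{\mathfrak{g}}(x)+[x,v]_V\quad(x\in\mathfrak{g}_{\bar 1},\ v\in V_{\bar 1}),$$ $$\alpha_{\mathfrak{g}\oplus V}(x+v):=\alpha(x)+\beta(v)\quad(x\in\mathfrak{g},\ v\in V).$$ Then $(\mathfrak{g}\oplus V,[\cdot,\cdot]_{\mathfrak{g}\oplus V},s_{\mathfrak{g}\oplus V},\alpha_{\mathfrak{g}\oplus V})$ is a Hom-Lie superalgebra in characteristic $2$.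
   Context: All vector spaces are over a field $\mathbb{K}$ of characteristic $2$. A map $s$ is a squaring if $s(\lambda x)=\lambda^2 s(x)$ for all $\lambda\in\mathbb{K}$. Hom-Lie algebra in characteristic 2: $(\mathfrak{g},[\cdot,\cdot],\alpha)$ with $[\cdot,\cdot]$ bilinear, $\alpha\in\mathrm{End}(\mathfrak{g})$, $[x,x]=0$, $\alpha([x,y])=[\alpha(x),\alpha(y)]$, and $[\alpha(x),[y,z]]+[\alpha(y),[z,x]]+[\alpha(z),[x,y]]=0$. A representation of it is $(V,[\cdot,\cdot]_V,\beta)$ with $\beta\in\mathfrak{gl}(V)$ and $[\cdot,\cdot]_V:\mathfrak{g}\times V\to V$ bilinear such that $[\alpha(x),\beta(v)]_V=\beta([x,v]_V)$ and $[[x,y],\beta(v)]_V=[\alpha(x),[y,v]_V]_V+[\alpha(y),[x,v]_V]_V$. Hom-Lie superalgebra in characteristic 2: a quadruple $(\mathfrak{g},[\cdot,\cdot],s,\alpha)$ with $\mathfrak{g}=\mathfrak{g}_{\bar 0}\oplus\mathfrak{g}_{\bar 1}$ a superspace, $[\cdot,\cdot]$ a symmetric bilinear bracket, $s:\mathfrak{g}_{\bar 1}\to\mathfrak{g}_{\bar 0}$ a squaring, and $\alpha\in\mathrm{End}(\mathfrak{g})$ even, such that (i) $(\mathfrak{g}_{\bar 0},[\cdot,\cdot],\alpha|_{\mathfrak{g}_{\bar 0}})$ is a Hom-Lie algebra; (ii) $\mathfrak{g}_{\bar 1}$ is a $\mathfrak{g}_{\bar 0}$-module (with twist $\alpha|_{\mathfrak{g}_{\bar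 1}}$) via the bracket, made two-sided by symmetry; (iii) the map $(x,y)\mapsto s(x+y)+s(x)+s(y)$ on $\mathfrak{g}_{\bar 1}\times\mathfrak{g}_{\bar 1}$ is bilinear and equals $[x,y]$; (iv) $[s(x),\alpha(y)]=[\alpha(x),[x,y]]$ for $x\in\mathfrak{g}_{\bar 1}$, $y\in\mathfrak{g}$; $\alpha([x,y])=[\alpha(x),\alpha(y)]$ for $x,y\in\mathfrak{g}$; and $\alpha(s(x))=s(\alpha(x))$ for $x\in\mathfrak{g}_{\bar 1}$. Representation of a Hom-Lie superalgebra $(\mathfrak{g},[\cdot,\cdot]_{\mathfrak{g}},s_{\mathfrak{g}},\alpha)$: a triple $(V,[\cdot,\cdot]_V,\beta)$ with $V$ a superspace, $\beta\in\mathfrak{gl}(V)$ even, and $[\cdot,\cdot]_V:\mathfrak{g}\times V\to V$ an even bilinear action such that $[\alpha(x),\beta(v)]_V=\beta([x,v]_V)$ for $x\in\mathfrak{g}$; $[[x,y]_{\mathfrak{g}},\beta(v)]_V=[\alpha(x),[y,v]_V]_V+[\alpha(y),[x,v]_V]_V$ for $x,y\in\mathfrak{g}$; and $[s_{\mathfrak{g}}(x),\beta(v)]_V=[\alpha(x),[x,v]_V]_V$ for $x\in\mathfrak{g}_{\bar 1}$; for all $v\in V$. *)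

theory Defs
  imports "HOL-Analysis.Product_Vector"
begin

definition linear_on ::
  "('k \<Rightarrow> 'a::ab_group_add \<Rightarrow> 'a) \<Rightarrow> 'a set \<Rightarrow> ('k \<Rightarrow> 'b::ab_group_add \<Rightarrow> 'b) \<Rightarrow> 'b set \<Rightarrow> ('a \<Rightarrow> 'b) \<Rightarrow> bool"
  where "linear_on sA A sB B f \<longleftrightarrow>
    (\<forall>x\<in>A. f x \<in> B) \<and>
    (\<forall>x\<in>A. \<forall>y\<in>A. f (x + y) = f x + f y) \<and>
    (\<forall>c. \<forall>x\<in>A. f (sA c x) = sB c (f x))"

definition bilinear_on ::
  "('k \<Rightarrow> 'a::ab_group_add \<Rightarrow> 'a) \<Rightarrow> 'a set \<Rightarrow> ('k \<Rightarrow> 'b::ab_group_add \<Rightarrow> 'b) \<Rightarrow> 'b set \<Rightarrow>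
   ('k \<Rightarrow> 'c::ab_group_add \<Rightarrow> 'c) \<Rightarrow> 'c set \<Rightarrow> ('a \<Rightarrow> 'b \<Rightarrow> 'c) \<Rightarrow> bool"
  where "bilinear_on sA A sB B sC C f \<longleftrightarrow>
    (\<forall>x\<in>A. linear_on sB B sC C (\<lambda>y. f x y)) \<and>
    (\<forall>y\<in>B. linear_on sA A sC C (\<lambda>x. f x y))"

text \<open>The even and odd parts of a superalgebra are subspaces of one type, so Hom-Lie algebras and
  their representations are given on carrier subspaces (\<open>L\<close> and \<open>M\<close> below).\<close>

locale hom_lie_algebra =
  vector_space scale
  for scale :: "'k::field \<Rightarrow> 'g::ab_group_add \<Rightarrow> 'g"
    and L :: "'g set" and br :: "'g \<Rightarrow> 'g \<Rightarrow> 'g" and \<alpha> :: "'g \<Rightarrow> 'g" +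
  assumes char_2: "CHAR('k) = 2"
    and subspace_L: "subspace L"
    and bilinear_br: "bilinear_on scale L scale L scale L br"
    and linear_twist: "linear_on scale L scale L \<alpha>"
    and br_self: "x \<in> L \<Longrightarrow> br x x = 0"
    and twist_br: "\<lbrakk>x \<in> L; y \<in> L\<rbrakk> \<Longrightarrow> \<alpha> (br x y) = br (\<alpha> x) (\<alpha> y)"
    and hom_jacobi: "\<lbrakk>x \<in> L; y \<in> L; z \<in> L\<rbrakk> \<Longrightarrow>
      br (\<alpha> x) (br y z) + br (\<alpha> y) (br z x) + br (\<alpha> z) (br x y) = 0"

locale hom_lie_representation =
  hom_lie_algebra scaleG L br \<alpha> + V: vector_space scaleV
  for scaleG :: "'k::field \<Rightarrow> 'g::ab_group_add \<Rightarrow> 'g"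
    and L :: "'g set" and br :: "'g \<Rightarrow> 'g \<Rightarrow> 'g" and \<alpha> :: "'g \<Rightarrow> 'g"
    and scaleV :: "'k \<Rightarrow> 'v::ab_group_add \<Rightarrow> 'v"
    and M :: "'v set" and act :: "'g \<Rightarrow> 'v \<Rightarrow> 'v" and \<beta> :: "'v \<Rightarrow> 'v" +
  assumes subspace_M: "V.subspace M"
    and bilinear_act: "bilinear_on scaleG L scaleV M scaleV M act"
    and linear_rep_twist: "linear_on scaleV M scaleV M \<beta>"
    and twist_act: "\<lbrakk>x \<in> L; v \<in> M\<rbrakk> \<Longrightarrow> act (\<alpha> x) (\<beta> v) = \<beta> (act x v)"
    and act_br: "\<lbrakk>x \<in> L; y \<in> L; v \<in> M\<rbrakk> \<Longrightarrow>
      act (br x y) (\<beta> v) = act (\<alpha> x) (act y v) + act (\<alpha> y) (act x v)"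

locale superspace =
  vector_space scale
  for scale :: "'k::field \<Rightarrow> 'v::ab_group_add \<Rightarrow> 'v"
    and V0 :: "'v set" and V1 :: "'v set" +
  assumes subspace_even: "subspace V0"
    and subspace_odd: "subspace V1"
    and even_Int_odd: "V0 \<inter> V1 = {0}"
    and even_plus_odd: "{a + b | a b. a \<in> V0 \<and> b \<in> V1} = UNIV"

text \<open>The squaring \<open>s\<close> is a total function, but only its values on the odd part \<open>G1\<close> are constrained.
  That the bracket respects the grading is a consequence of \<open>even_part\<close>, \<open>odd_part\<close> and
  \<open>polarization\<close>.\<close>

locale hom_lie_superalgebra =
  superspace scale G0 G1
  for scale :: "'k::field \<Rightarrow> 'g::ab_group_add \<Rightarrow> 'g"
    and G0 :: "'g set" and G1 :: "'g set"
    and br :: "'g \<Rightarrow> 'g \<Rightarrow> 'g" and s :: "'g \<Rightarrow> 'g" and \<alpha> :: "'g \<Rightarrow> 'g" +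
  assumes super_char_2: "CHAR('k) = 2"
    and super_bilinear_br: "bilinear_on scale UNIV scale UNIV scale UNIV br"
    and br_sym: "br x y = br y x"
    and s_even: "x \<in> G1 \<Longrightarrow> s x \<in> G0"
    and s_scale: "x \<in> G1 \<Longrightarrow> s (scale c x) = scale (c\<^sup>2) (s x)"
    and super_linear_twist: "Vector_Spaces.linear scale scale \<alpha>"
    and super_twist_even: "\<alpha> ` G0 \<subseteq> G0" "\<alpha> ` G1 \<subseteq> G1"
    and even_part: "hom_lie_algebra scale G0 br \<alpha>"
    and odd_part: "hom_lie_representation scale G0 br \<alpha> scale G1 br \<alpha>"
    and polarization_bilinear:
      "bilinear_on scale G1 scale G1 scale G0 (\<lambda>x y. s (x + y) + s x + s y)"
    and polarization: "\<lbrakk>x \<in> G1; y \<in> G1\<rbrakk> \<Longrightarrow> s (x + y) + s x + s y = br x y"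
    and br_s: "x \<in> G1 \<Longrightarrow> br (s x) (\<alpha> y) = br (\<alpha> x) (br x y)"
    and super_twist_br: "\<alpha> (br x y) = br (\<alpha> x) (\<alpha> y)"
    and twist_s: "x \<in> G1 \<Longrightarrow> \<alpha> (s x) = s (\<alpha> x)"

locale hom_lie_superalgebra_representation =
  hom_lie_superalgebra scaleG G0 G1 br s \<alpha> + V: superspace scaleV V0 V1
  for scaleG :: "'k::field \<Rightarrow> 'g::ab_group_add \<Rightarrow> 'g"
    and G0 :: "'g set" and G1 :: "'g set"
    and br :: "'g \<Rightarrow> 'g \<Rightarrow> 'g" and s :: "'g \<Rightarrow> 'g" and \<alpha> :: "'g \<Rightarrow> 'g"
    and scaleV :: "'k \<Rightarrow> 'v::ab_group_add \<Rightarrow> 'v"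
    and V0 :: "'v set" and V1 :: "'v set"
    and act :: "'g \<Rightarrow> 'v \<Rightarrow> 'v" and \<beta> :: "'v \<Rightarrow> 'v" +
  assumes super_linear_rep_twist: "Vector_Spaces.linear scaleV scaleV \<beta>"
    and super_rep_twist_even: "\<beta> ` V0 \<subseteq> V0" "\<beta> ` V1 \<subseteq> V1"
    and super_bilinear_act: "bilinear_on scaleG UNIV scaleV UNIV scaleV UNIV act"
    and act_even_even: "\<lbrakk>x \<in> G0; v \<in> V0\<rbrakk> \<Longrightarrow> act x v \<in> V0"
    and act_even_odd: "\<lbrakk>x \<in> G0; v \<in> V1\<rbrakk> \<Longrightarrow> act x v \<in> V1"
    and act_odd_even: "\<lbrakk>x \<in> G1; v \<in> V0\<rbrakk> \<Longrightarrow> act x v \<in> V1"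
    and act_odd_odd: "\<lbrakk>x \<in> G1; v \<in> V1\<rbrakk> \<Longrightarrow> act x v \<in> V0"
    and super_twist_act: "act (\<alpha> x) (\<beta> v) = \<beta> (act x v)"
    and super_act_br: "act (br x y) (\<beta> v) = act (\<alpha> x) (act y v) + act (\<alpha> y) (act x v)"
    and act_s: "x \<in> G1 \<Longrightarrow> act (s x) (\<beta> v) = act (\<alpha> x) (act x v)"

text \<open>The direct sum of the two superspaces is the product type, with \<open>(x, v)\<close> standing for
  \<open>x + v\<close>.\<close>

definition semidirect_br ::
  "('g \<Rightarrow> 'g \<Rightarrow> 'g) \<Rightarrow> ('g \<Rightarrow> 'v \<Rightarrow> 'v::ab_group_add) \<Rightarrow> 'g \<times> 'v \<Rightarrow> 'g \<times> 'v \<Rightarrow> 'g \<times> 'v"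
  where "semidirect_br br act = (\<lambda>(x, v) (y, w). (br x y, act x w + act y v))"

definition semidirect_s :: "('g \<Rightarrow> 'g) \<Rightarrow> ('g \<Rightarrow> 'v \<Rightarrow> 'v) \<Rightarrow> 'g \<times> 'v \<Rightarrow> 'g \<times> 'v"
  where "semidirect_s s act = (\<lambda>(x, v). (s x, act x v))"

definition semidirect_twist :: "('g \<Rightarrow> 'g) \<Rightarrow> ('v \<Rightarrow> 'v) \<Rightarrow> 'g \<times> 'v \<Rightarrow> 'g \<times> 'v"
  where "semidirect_twist \<alpha> \<beta> = (\<lambda>(x, v). (\<alpha> x, \<beta> v))"

end

theory Submission
  imports Defs
begin

text \<open>
  The \<open>\<gg>\<close>-component of every axiom for \<open>\<gg> \<oplus> V\<close> is the same axiom for \<open>\<gg>\<close>, so only the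
  \<open>V\<close>-components need an argument. There the bracket of \<open>V\<close> with itself is zero, and each axiom,
  expanded by bilinearity, becomes a sum of iterated actions. The three representation axioms rewrite the
  actions of \<open>\<alpha>(x)\<close>, \<open>[x, y]\<close> and \<open>s(x)\<close> on \<open>\<beta>(v)\<close>; what is left over occurs twice and
  vanishes because \<open>a + a = 0\<close>.

  Two observations shorten the work. In characteristic \<open>2\<close> the Hom-Jacobi identity of \<open>\<gg>\<^sub>0\<close> and the
  module identity of \<open>\<gg>\<^sub>1\<close> both say that
  \<open>[[x, y], \<alpha>(z)] = [\<alpha>(x), [y, z]] + [\<alpha>(y), [x, z]]\<close>, up to the symmetry of the bracket, so lifting
  this identity from \<open>\<gg>\<close> to \<open>\<gg> \<oplus> V\<close> (\<open>semidirect_leibniz\<close>) settles both. Moreover, the polar form of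
  \<open>(x, v) \<mapsto> (s(x), [x, v])\<close> is the semidirect bracket built from the polar form of \<open>s\<close>
  (\<open>semidirect_polar\<close>), so its bilinearity is an instance of \<open>bilinear_on_semidirect\<close>, just like that of
  the bracket on each graded piece.
\<close>

section \<open>Characteristic two\<close>

lemma (in vector_space) char_2_add_self:
  fixes x :: 'b
  assumes "CHAR('a) = 2"
  shows "x + x = 0"
proof -
  have "(2 :: 'a) = 0"
    using of_nat_CHAR[where 'a = 'a] assms by simp
  moreover have "x + x = scale (1 + 1) x"
    by (simp only: scale_left_distrib scale_one)
  ultimately show ?thesis by simp
qed

lemma (in vector_space) char_2_add_left_self:
  fixes x :: 'b
  assumes "CHAR('a) = 2"
  shows "x + (x + y) = y"
  using char_2_add_self[OF assms, of x] by (simp flip: add.assoc)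

section \<open>Linear and bilinear maps on subspaces\<close>

lemma linear_on_restrict:
  assumes "linear_on sA UNIV sB UNIV f" "\<And>x. x \<in> A \<Longrightarrow> f x \<in> B"
  shows "linear_on sA A sB B f"
  using assms by (simp add: linear_on_def)

lemma bilinear_on_restrict:
  assumes "bilinear_on sA UNIV sB UNIV sC UNIV f" "\<And>x y. x \<in> A \<Longrightarrow> y \<in> B \<Longrightarrow> f x y \<in> C"
  shows "bilinear_on sA A sB B sC C f"
  using assms by (simp add: bilinear_on_def linear_on_restrict)

context vector_space_prod
begin

lemma linear_on_semidirect_twist:
  assumes "linear_on s1 A s1 A' f" "linear_on s2 B s2 B' g"
  shows "linear_on scale (A \<times> B) scale (A' \<times> B') (semidirect_twist f g)"
  using assms by (auto simp: linear_on_def semidirect_twist_def scale_prod)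

text \<open>Three pairs of subspaces are allowed, because the bracket of \<open>\<gg> \<oplus> V\<close> has to be bilinear on
  even times even and on even times odd elements, and its polar form on odd times odd elements. The
  two actions in the \<open>V\<close>-component then have different domains and only share their target \<open>N\<close>.\<close>

lemma bilinear_on_semidirect:
  assumes br: "bilinear_on s1 A s1 B s1 C br"
    and act1: "bilinear_on s1 A s2 M s2 N act"
    and act2: "bilinear_on s1 B s2 L s2 N act"
    and N: "vs2.subspace N"
  shows "bilinear_on scale (A \<times> L) scale (B \<times> M) scale (C \<times> N) (semidirect_br br act)"
  using br act1 act2 N vs2.subspace_add[OF N]
  by (auto simp: bilinear_on_def linear_on_def semidirect_br_def scale_prod
      vs2.scale_right_distrib algebra_simps)

end

lemma superspace_prod:
  assumes "superspace sG G0 G1" "superspace sV V0 V1"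
  shows "superspace (module_prod.scale sG sV) (G0 \<times> V0) (G1 \<times> V1)"
proof -
  interpret G: superspace sG G0 G1 by fact
  interpret V: superspace sV V0 V1 by fact
  interpret P: vector_space_prod sG sV ..
  have "\<exists>a b. p = a + b \<and> a \<in> G0 \<times> V0 \<and> b \<in> G1 \<times> V1" for p
  proof -
    have "fst p \<in> {a + b | a b. a \<in> G0 \<and> b \<in> G1}" "snd p \<in> {a + b | a b. a \<in> V0 \<and> b \<in> V1}"
      using G.even_plus_odd V.even_plus_odd by auto
    then obtain a b c d where
      "fst p = a + b" "a \<in> G0" "b \<in> G1" "snd p = c + d" "c \<in> V0" "d \<in> V1"
      by blast
    then show ?thesis
      by (intro exI[of _ "(a, c)"] exI[of _ "(b, d)"]) (auto simp: prod_eq_iff)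
  qed
  moreover have "(G0 \<times> V0) \<inter> (G1 \<times> V1) = {0}"
    using G.even_Int_odd V.even_Int_odd by (simp add: Times_Int_Times zero_prod_def)
  ultimately show ?thesis
    by unfold_locales
      (auto intro: P.subspace_Times G.subspace_even G.subspace_odd V.subspace_even V.subspace_odd)
qed

section \<open>The semidirect product\<close>

context hom_lie_superalgebra_representation
begin

interpretation P: vector_space_prod scaleG scaleV ..

abbreviation "sd_br \<equiv> semidirect_br br act"
abbreviation "sd_s \<equiv> semidirect_s s act"
abbreviation "sd_twist \<equiv> semidirect_twist \<alpha> \<beta>"

lemma act_add:
  "act (x + y) v = act x v + act y v"
  "act x (v + w) = act x v + act x w"
  using super_bilinear_act by (simp_all add: bilinear_on_def linear_on_def)

lemma act_scale:
  "act (scaleG c x) v = scaleV c (act x v)"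
  "act x (scaleV c v) = scaleV c (act x v)"
  using super_bilinear_act by (simp_all add: bilinear_on_def linear_on_def)

lemma rep_twist_add: "\<beta> (v + w) = \<beta> v + \<beta> w"
  using super_linear_rep_twist by (simp add: Vector_Spaces.linear_iff)

lemmas V_add_self = V.char_2_add_self[OF super_char_2] V.char_2_add_left_self[OF super_char_2]

lemma bilinear_act_parts:
  "bilinear_on scaleG G0 scaleV V0 scaleV V0 act"
  "bilinear_on scaleG G0 scaleV V1 scaleV V1 act"
  "bilinear_on scaleG G1 scaleV V0 scaleV V1 act"
  "bilinear_on scaleG G1 scaleV V1 scaleV V0 act"
  by (rule bilinear_on_restrict[OF super_bilinear_act];
      simp add: act_even_even act_even_odd act_odd_even act_odd_odd)+

lemma linear_rep_twist_parts:
  "linear_on scaleV UNIV scaleV UNIV \<beta>"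
  "linear_on scaleV V0 scaleV V0 \<beta>"
  "linear_on scaleV V1 scaleV V1 \<beta>"
  using super_linear_rep_twist super_rep_twist_even
  by (auto simp: Vector_Spaces.linear_iff linear_on_def)

lemma semidirect_br_sym: "sd_br p q = sd_br q p"
  by (simp add: semidirect_br_def br_sym add.commute split: prod.split)

lemma semidirect_twist_br: "sd_twist (sd_br p q) = sd_br (sd_twist p) (sd_twist q)"
  by (simp add: semidirect_br_def semidirect_twist_def super_twist_br super_twist_act rep_twist_add
      split: prod.split)

text \<open>For \<open>x + v\<close>, \<open>y + w\<close> and \<open>z + u\<close>, the \<open>V\<close>-component contains the representation identity
  for each of the pairs \<open>(x, y)\<close>, \<open>(y, z)\<close> and \<open>(x, z)\<close>. The latter two contribute the doubled terms
  \<open>[\<alpha>(z), [y, v]]\<close> and \<open>[\<alpha>(z), [x, w]]\<close>, which cancel. The \<open>\<gg>\<close>-component is a hypothesis because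
  it comes from the Hom-Jacobi identity for \<open>z\<close> even and from the module identity for \<open>z\<close> odd.\<close>

lemma semidirect_leibniz:
  assumes "br (br (fst p) (fst q)) (\<alpha> (fst r)) =
    br (\<alpha> (fst p)) (br (fst q) (fst r)) + br (\<alpha> (fst q)) (br (fst p) (fst r))"
  shows "sd_br (sd_br p q) (sd_twist r) =
    sd_br (sd_twist p) (sd_br q r) + sd_br (sd_twist q) (sd_br p r)"
  using assms
  by (cases p; cases q; cases r)
    (simp add: semidirect_br_def semidirect_twist_def act_add super_act_br V_add_self ac_simps)

lemma even_leibniz:
  assumes "x \<in> G0" "y \<in> G0" "z \<in> G0"
  shows "br (br x y) (\<alpha> z) = br (\<alpha> x) (br y z) + br (\<alpha> y) (br x z)"
proof -
  let ?b = "br (\<alpha> x) (br y z) + br (\<alpha> y) (br x z)"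
  have "?b + br (br x y) (\<alpha> z) = 0"
    using hom_lie_algebra.hom_jacobi[OF even_part assms]
    by (simp add: br_sym[of _ x] br_sym[of _ "\<alpha> z"])
  then have "?b + br (br x y) (\<alpha> z) = ?b + ?b"
    by (simp only: char_2_add_self[OF super_char_2])
  then show ?thesis by (simp only: add_left_cancel)
qed

lemma semidirect_hom_lie_algebra:
  "hom_lie_algebra P.scale (G0 \<times> V0) sd_br sd_twist"
proof unfold_locales
  show "CHAR('k) = 2" by (fact super_char_2)
  show "P.p.subspace (G0 \<times> V0)"
    by (intro P.subspace_Times subspace_even V.subspace_even)
  show "bilinear_on P.scale (G0 \<times> V0) P.scale (G0 \<times> V0) P.scale (G0 \<times> V0) sd_br"
    by (intro P.bilinear_on_semidirect bilinear_act_parts V.subspace_even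
        hom_lie_algebra.bilinear_br[OF even_part])
  show "linear_on P.scale (G0 \<times> V0) P.scale (G0 \<times> V0) sd_twist"
    by (intro P.linear_on_semidirect_twist linear_rep_twist_parts
        hom_lie_algebra.linear_twist[OF even_part])
  fix p q r
  assume p: "p \<in> G0 \<times> V0"
  then show "sd_br p p = 0"
    by (auto simp: semidirect_br_def zero_prod_def V_add_self hom_lie_algebra.br_self[OF even_part])
  show "sd_twist (sd_br p q) = sd_br (sd_twist p) (sd_twist q)"
    by (fact semidirect_twist_br)
  assume "q \<in> G0 \<times> V0" "r \<in> G0 \<times> V0"
  with p have "sd_br (sd_br p q) (sd_twist r) =
      sd_br (sd_twist p) (sd_br q r) + sd_br (sd_twist q) (sd_br p r)"
    by (intro semidirect_leibniz even_leibniz) auto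
  then show "sd_br (sd_twist p) (sd_br q r) + sd_br (sd_twist q) (sd_br r p) +
      sd_br (sd_twist r) (sd_br p q) = 0"
    by (simp add: semidirect_br_sym[of r p] semidirect_br_sym[of "sd_twist r"]
        P.p.char_2_add_self[OF super_char_2])
qed

lemma semidirect_hom_lie_representation:
  "hom_lie_representation P.scale (G0 \<times> V0) sd_br sd_twist P.scale (G1 \<times> V1) sd_br sd_twist"
proof -
  interpret A: hom_lie_algebra P.scale "G0 \<times> V0" sd_br sd_twist
    by (fact semidirect_hom_lie_algebra)
  show ?thesis
  proof unfold_locales
    show "P.p.subspace (G1 \<times> V1)"
      by (intro P.subspace_Times subspace_odd V.subspace_odd)
    show "bilinear_on P.scale (G0 \<times> V0) P.scale (G1 \<times> V1) P.scale (G1 \<times> V1) sd_br"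
      by (intro P.bilinear_on_semidirect bilinear_act_parts V.subspace_odd
          hom_lie_representation.bilinear_act[OF odd_part])
    show "linear_on P.scale (G1 \<times> V1) P.scale (G1 \<times> V1) sd_twist"
      by (intro P.linear_on_semidirect_twist linear_rep_twist_parts
          hom_lie_representation.linear_rep_twist[OF odd_part])
    fix p q r
    show "sd_br (sd_twist p) (sd_twist r) = sd_twist (sd_br p r)"
      by (simp only: semidirect_twist_br)
    assume "p \<in> G0 \<times> V0" "q \<in> G0 \<times> V0" "r \<in> G1 \<times> V1"
    then show "sd_br (sd_br p q) (sd_twist r) =
        sd_br (sd_twist p) (sd_br q r) + sd_br (sd_twist q) (sd_br p r)"
      by (intro semidirect_leibniz hom_lie_representation.act_br[OF odd_part]) auto
  qed
qed

text \<open>This holds on all of \<open>\<gg> \<oplus> V\<close>: expanding \<open>[x + y, v + w]\<close>, the diagonal terms \<open>[x, v]\<close> and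
  \<open>[y, w]\<close> cancel against the two other squares.\<close>

lemma semidirect_polar:
  "sd_s (p + q) + sd_s p + sd_s q = semidirect_br (\<lambda>x y. s (x + y) + s x + s y) act p q"
  by (cases p; cases q)
    (simp add: semidirect_s_def semidirect_br_def act_add V_add_self ac_simps)

text \<open>For \<open>x + v\<close> and \<open>y + w\<close> two representation axioms meet: \<open>act_s\<close> turns \<open>[s(x), \<beta>(w)]\<close> into
  \<open>[\<alpha>(x), [x, w]]\<close>, while \<open>super_act_br\<close> expands \<open>[[x, y], \<beta>(v)]\<close> on the other side, where the
  term \<open>[\<alpha>(x), [y, v]]\<close> then occurs twice.\<close>

lemma semidirect_br_s:
  assumes "p \<in> G1 \<times> V1"
  shows "sd_br (sd_s p) (sd_twist q) = sd_br (sd_twist p) (sd_br p q)"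
  using assms
  by (cases p; cases q)
    (simp add: semidirect_br_def semidirect_s_def semidirect_twist_def act_add br_s act_s
      super_act_br V_add_self ac_simps)

lemma semidirect_hom_lie_superalgebra:
  "hom_lie_superalgebra P.scale (G0 \<times> V0) (G1 \<times> V1) sd_br sd_s sd_twist"
proof -
  have "superspace P.scale (G0 \<times> V0) (G1 \<times> V1)"
    by (rule superspace_prod) unfold_locales
  then show ?thesis
  proof (intro hom_lie_superalgebra.intro hom_lie_superalgebra_axioms.intro)
    show "CHAR('k) = 2" by (fact super_char_2)
    show "bilinear_on P.scale UNIV P.scale UNIV P.scale UNIV sd_br"
      using P.bilinear_on_semidirect[OF super_bilinear_br super_bilinear_act super_bilinear_act]
      by simp
    show "Vector_Spaces.linear P.scale P.scale sd_twist"
    proof -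
      have "linear_on scaleG UNIV scaleG UNIV \<alpha>"
        using super_linear_twist by (simp add: Vector_Spaces.linear_iff linear_on_def)
      from P.linear_on_semidirect_twist[OF this linear_rep_twist_parts(1)] show ?thesis
        by (simp add: Vector_Spaces.linear_iff linear_on_def P.p.vector_space_axioms)
    qed
    show "sd_twist ` (G0 \<times> V0) \<subseteq> G0 \<times> V0" "sd_twist ` (G1 \<times> V1) \<subseteq> G1 \<times> V1"
      using super_twist_even super_rep_twist_even by (auto simp: semidirect_twist_def)
    show "hom_lie_algebra P.scale (G0 \<times> V0) sd_br sd_twist"
      by (fact semidirect_hom_lie_algebra)
    show "hom_lie_representation P.scale (G0 \<times> V0) sd_br sd_twist P.scale (G1 \<times> V1) sd_br sd_twist"
      by (fact semidirect_hom_lie_representation)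
    show "bilinear_on P.scale (G1 \<times> V1) P.scale (G1 \<times> V1) P.scale (G0 \<times> V0)
        (\<lambda>p q. sd_s (p + q) + sd_s p + sd_s q)"
      unfolding semidirect_polar
      by (intro P.bilinear_on_semidirect polarization_bilinear bilinear_act_parts V.subspace_even)
    fix p q c
    show "sd_br p q = sd_br q p" by (fact semidirect_br_sym)
    show "sd_twist (sd_br p q) = sd_br (sd_twist p) (sd_twist q)" by (fact semidirect_twist_br)
    assume p: "p \<in> G1 \<times> V1"
    then show "sd_s p \<in> G0 \<times> V0"
      by (auto simp: semidirect_s_def s_even act_odd_odd)
    show "sd_s (P.scale c p) = P.scale (c\<^sup>2) (sd_s p)"
      using p by (auto simp: semidirect_s_def P.scale_prod s_scale act_scale power2_eq_square)
    show "sd_br (sd_s p) (sd_twist q) = sd_br (sd_twist p) (sd_br p q)"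
      using p by (rule semidirect_br_s)
    show "sd_twist (sd_s p) = sd_s (sd_twist p)"
      using p by (auto simp: semidirect_s_def semidirect_twist_def twist_s super_twist_act)
    assume "q \<in> G1 \<times> V1"
    with p show "sd_s (p + q) + sd_s p + sd_s q = sd_br p q"
      unfolding semidirect_polar by (auto simp: semidirect_br_def polarization)
  qed
qed

end

theorem theorem3p2:
  fixes scaleG :: "'k::field \<Rightarrow> 'g::ab_group_add \<Rightarrow> 'g"
    and scaleV :: "'k \<Rightarrow> 'v::ab_group_add \<Rightarrow> 'v"
    and G0 G1 :: "'g set" and V0 V1 :: "'v set"
    and br :: "'g \<Rightarrow> 'g \<Rightarrow> 'g" and s \<alpha> :: "'g \<Rightarrow> 'g"
    and act :: "'g \<Rightarrow> 'v \<Rightarrow> 'v" and \<beta> :: "'v \<Rightarrow> 'v"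
  assumes "hom_lie_superalgebra scaleG G0 G1 br s \<alpha>"
    and "hom_lie_superalgebra_representation scaleG G0 G1 br s \<alpha> scaleV V0 V1 act \<beta>"
  shows "hom_lie_superalgebra (module_prod.scale scaleG scaleV) (G0 \<times> V0) (G1 \<times> V1)
    (semidirect_br br act) (semidirect_s s act) (semidirect_twist \<alpha> \<beta>)"
  using assms(2) by (rule hom_lie_superalgebra_representation.semidirect_hom_lie_superalgebra)

end
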